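(* Let $k\ge 1$ and $k\le r\le 2k$ be integers. The expected numbers $a_n^{(r)}$ of $r$-gaps in the parking process on a row of $n+k-1$ slots satisfy $$a_n^{(r)}=\frac{2}{n-k-1}\sum_{i=1}^{n-k-1}a_i^{(r)}\qquad\text{for all } n\ge k+2,$$ together with the initial conditions $$a_n^{(r)}=\begin{cases}1 & \text{if } n=r-k+1,\\ 0 & \text{if } 1\le n\le k+1,\ n\ne r-k+1.\end{cases}$$
   Context: Parking process. Fix an integer $k\ge 1$. For an integer $n\ge 1$ consider a row of $n+k-1$ parking slots labelled $1,2,\dots,n+k-1$. Cars arrive one by one. At any stage a slot is available if, after occupying it, every gap between neighboring occupied slots, as well as the gap before the first occupied slot and the gap after the last occupied slot, contains at least $k$ unoccupied slots (equivalently, distinct occupied slots are at distance at least $k+1$ and there are at least $k$ unoccupied slots at each end of the row). Each arriving car occupies one of the currently available slots, chosen uniformly at random among them (given the past). The process stops when no slot is available. A gap is a maximal block of consecutive unoccupied slots in the final configuration (between neighboring cars, before the first car, or after the last car; if no car can park, the whole row is a single gap). The final gaps have sizes in $\{k,k+1,\dots,2k\}$; an $r$-gap is a gap consisting of exactly $r$ slots. For $k\le r\le 2k$ and $n\ge 1$, $a_n^{(r)}$ denotes the expected number of $r$-gaps at the end of the process on the row of $n+k-1$ slots. *)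

theory Defs
  imports "HOL-Probability.Probability"
begin

text \<open>
  The row of \<open>L\<close> slots is \<open>{1..L}\<close> and a configuration is the set \<open>S\<close> of occupied slots.
  Adding the sentinels \<open>0\<close> and \<open>L + 1\<close> makes the gaps before the first and after the last car
  (and the whole row, if there is no car) instances of gaps between neighbours. Empty gaps,
  for example between two adjacent cars, are kept: they are what makes a
  configuration inadmissible.
\<close>

definition gaps :: "nat \<Rightarrow> nat set \<Rightarrow> nat set set" where
  "gaps L S = {{x<..<y} | x y. x \<in> S \<union> {0, L + 1} \<and> y \<in> S \<union> {0, L + 1} \<and> x < y \<and>
                 (S \<union> {0, L + 1}) \<inter> {x<..<y} = {}}"

definition available :: "nat \<Rightarrow> nat \<Rightarrow> nat set \<Rightarrow> nat set" where
  "available k L S = {s \<in> {1..L} - S. \<forall>g \<in> gaps L (insert s S). k \<le> card g}"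

text \<open>The stopped process is frozen in its final configuration.\<close>

definition park_step :: "nat \<Rightarrow> nat \<Rightarrow> nat set \<Rightarrow> nat set pmf" where
  "park_step k L S =
     (if available k L S = {} then return_pmf S
      else map_pmf (\<lambda>s. insert s S) (pmf_of_set (available k L S)))"

primrec config :: "nat \<Rightarrow> nat \<Rightarrow> nat \<Rightarrow> nat set pmf" where
  "config k L 0 = return_pmf {}"
| "config k L (Suc t) = bind_pmf (config k L t) (park_step k L)"

text \<open>At most \<open>L\<close> cars can park, so after \<open>L\<close> steps the process has stopped; this is
  the lemma \<open>final_config_stopped\<close> below.\<close>

definition final_config :: "nat \<Rightarrow> nat \<Rightarrow> nat set pmf" where
  "final_config k L = config k L L"

definition num_gaps :: "nat \<Rightarrow> nat \<Rightarrow> nat set \<Rightarrow> nat" where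
  "num_gaps r L S = card {g \<in> gaps L S. card g = r}"

definition expected_gaps :: "nat \<Rightarrow> nat \<Rightarrow> nat \<Rightarrow> real" where
  "expected_gaps k r n =
     measure_pmf.expectation (final_config k (n + k - 1)) (\<lambda>S. real (num_gaps r (n + k - 1) S))"

lemma finite_available: "finite (available k L S)"
  by (rule finite_subset[of _ "{1..L}"]) (auto simp: available_def)

lemma config_invariant:
  assumes "S \<in> set_pmf (config k L t)"
  shows "S \<subseteq> {1..L} \<and> (available k L S = {} \<or> card S = t)"
  using assms
proof (induction t arbitrary: S)
  case 0
  then show ?case by simp
next
  case (Suc t)
  then obtain T where T: "T \<in> set_pmf (config k L t)" "S \<in> set_pmf (park_step k L T)"
    by auto
  have IH: "T \<subseteq> {1..L}" "available k L T = {} \<or> card T = t"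
    using Suc.IH[OF T(1)] by auto
  show ?case
  proof (cases "available k L T = {}")
    case True
    then show ?thesis using T(2) IH by (simp add: park_step_def)
  next
    case False
    then obtain s where s: "s \<in> available k L T" "S = insert s T"
      using T(2) by (auto simp: park_step_def finite_available)
    have "finite T" using IH(1) finite_subset by blast
    moreover have "s \<in> {1..L}" "s \<notin> T" using s(1) by (auto simp: available_def)
    ultimately show ?thesis using s IH False by auto
  qed
qed

lemma final_config_stopped:
  assumes "S \<in> set_pmf (final_config k L)"
  shows "available k L S = {}"
proof (rule ccontr)
  assume ne: "available k L S \<noteq> {}"
  then have "S \<subseteq> {1..L}" "card S = card {1..L}"
    using config_invariant assms unfolding final_config_def by fastforce+
  then have "S = {1..L}" by (simp add: card_subset_eq)
  then show False using ne by (auto simp: available_def)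
qed

end

theory Submission
  imports Defs
begin

text \<open>
  Let \<open>v m\<close> be the solution of the recurrence, indexed by the size \<open>m = n + k - 1\<close> of the row.
  The potential of a configuration is the sum of \<open>v\<close> over the sizes of its gaps. A car
  that parks in a gap of size \<open>m > 2k\<close> leaves \<open>j\<close> free slots to its left and \<open>m - 1 - j\<close> to its
  right, with \<open>j\<close> uniform on \<open>{k..<m-k}\<close>, so the recurrence says exactly that, gap by gap, the
  potential is preserved on average. In a stopped configuration all gaps have size at
  most \<open>2k\<close> and the potential counts the \<open>r\<close>-gaps, so the expected number of \<open>r\<close>-gaps is the
  initial potential \<open>v (n + k - 1)\<close>.
\<close>

section \<open>The recurrence, indexed by the size of a gap\<close>

text \<open>The base range consists of the sizes in which no further car fits, as a car needs
  \<open>k\<close> free slots on each side. In the recursive branch \<open>j\<close> is the size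
  left on one side of the car; the factor 2 accounts for the two sides.\<close>

function gap_value :: "nat \<Rightarrow> nat \<Rightarrow> nat \<Rightarrow> real" where
  "gap_value k r m =
     (if m \<le> 2 * k then of_bool (m = r)
      else 2 / (real m - 2 * real k) * (\<Sum>j = k..<m - k. gap_value k r j))"
  by auto
termination
  by (relation "Wellfounded.measure (\<lambda>(k, r, m). m)") auto

declare gap_value.simps [simp del]

lemma gap_value_small: "m \<le> 2 * k \<Longrightarrow> gap_value k r m = of_bool (m = r)"
  by (subst gap_value.simps) simp

lemma gap_value_large:
  "2 * k < m \<Longrightarrow>
    gap_value k r m = 2 / (real m - 2 * real k) * (\<Sum>j = k..<m - k. gap_value k r j)"
  by (subst gap_value.simps) simp

section \<open>Combinatorics of gaps\<close>

lemma gap_cases: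
  assumes "g \<in> gaps L S"
  obtains x y where "g = {x<..<y}" "x \<in> S \<union> {0, L + 1}" "y \<in> S \<union> {0, L + 1}" "x < y"
    "(S \<union> {0, L + 1}) \<inter> {x<..<y} = {}"
  using assms unfolding gaps_def mem_Collect_eq by (elim exE conjE)

lemma gapI:
  assumes "x \<in> S \<union> {0, L + 1}" "y \<in> S \<union> {0, L + 1}" "x < y"
    "(S \<union> {0, L + 1}) \<inter> {x<..<y} = {}"
  shows "{x<..<y} \<in> gaps L S"
  unfolding gaps_def mem_Collect_eq using assms by (intro exI[of _ x] exI[of _ y] conjI refl)

lemma finite_gaps:
  assumes "S \<subseteq> {1..L}"
  shows "finite (gaps L S)"
proof -
  have "finite (S \<union> {0, L + 1})"
    using assms finite_subset by auto
  moreover have "gaps L S \<subseteq> (\<lambda>(x, y). {x<..<y}) ` ((S \<union> {0, L + 1}) \<times> (S \<union> {0, L + 1}))"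
    unfolding gaps_def by auto
  ultimately show ?thesis
    by (meson finite_SigmaI finite_imageI finite_subset)
qed

lemma gaps_empty: "gaps L {} = {{0<..<L + 1}}"
  unfolding gaps_def by auto

lemma gap_disjoint_config: "g \<in> gaps L S \<Longrightarrow> g \<inter> S = {}"
  unfolding gaps_def by auto

lemma gap_subset:
  assumes "S \<subseteq> {1..L}" "g \<in> gaps L S"
  shows "g \<subseteq> {1..L}"
proof -
  obtain x y where "g = {x<..<y}" "x \<in> S \<union> {0, L + 1}" "y \<in> S \<union> {0, L + 1}"
    using assms(2) by (rule gap_cases)
  then have "g = {x<..<y}" "y \<le> L + 1"
    using assms(1) by auto
  then show ?thesis
    by auto
qed

text \<open>An endpoint of either gap is a car or a sentinel, so it cannot lie strictly inside the
  other gap; two such intervals around a common slot must have the same ends.\<close>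

lemma gaps_unique:
  assumes "g \<in> gaps L S" "h \<in> gaps L S" "s \<in> g" "s \<in> h"
  shows "g = h"
proof -
  let ?T = "S \<union> {0, L + 1}"
  obtain x y where g: "g = {x<..<y}" "x \<in> ?T" "y \<in> ?T" "?T \<inter> {x<..<y} = {}"
    using assms(1) by (rule gap_cases)
  obtain u v where h: "h = {u<..<v}" "u \<in> ?T" "v \<in> ?T" "?T \<inter> {u<..<v} = {}"
    using assms(2) by (rule gap_cases)
  have s: "x < s" "s < y" "u < s" "s < v"
    using assms(3,4) g(1) h(1) by auto
  have "u \<notin> {x<..<y}" "v \<notin> {x<..<y}" "x \<notin> {u<..<v}" "y \<notin> {u<..<v}"
    using g(2,3,4) h(2,3,4) by (metis IntI empty_iff)+
  then have "x = u" "y = v"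
    using s by auto
  then show ?thesis
    using g(1) h(1) by simp
qed

text \<open>The gap is bounded by the nearest car or sentinel on each side of \<open>s\<close>. The
  sentinels ensure that both neighbours exist.\<close>

lemma ex_gap:
  assumes "S \<subseteq> {1..L}" "s \<in> {1..L} - S"
  shows "\<exists>g \<in> gaps L S. s \<in> g"
proof -
  let ?T = "S \<union> {0, L + 1}"
  have fin: "finite ?T"
    using assms(1) finite_subset by auto
  define x where "x = Max (?T \<inter> {..<s})"
  define y where "y = Min (?T \<inter> {s<..})"
  have "0 \<in> ?T \<inter> {..<s}" "L + 1 \<in> ?T \<inter> {s<..}"
    using assms(2) by auto
  then have x: "x \<in> ?T \<inter> {..<s}" and y: "y \<in> ?T \<inter> {s<..}"
    unfolding x_def y_def using fin by (metis Max_in Min_in empty_iff finite_Int)+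
  have "t \<notin> {x<..<y}" if "t \<in> ?T" for t
  proof -
    have "t \<noteq> s"
      using that assms(2) by auto
    then consider "t < s" | "s < t"
      by linarith
    then show ?thesis
    proof cases
      case 1
      then have "t \<le> x"
        unfolding x_def using that fin by (intro Max_ge) auto
      then show ?thesis by simp
    next
      case 2
      then have "y \<le> t"
        unfolding y_def using that fin by (intro Min_le) auto
      then show ?thesis by simp
    qed
  qed
  then have "?T \<inter> {x<..<y} = {}"
    by blast
  then have "{x<..<y} \<in> gaps L S"
    using x y by (intro gapI) auto
  moreover have "s \<in> {x<..<y}"
    using x y by simp
  ultimately show ?thesis
    by (rule bexI[rotated])
qed

text \<open>Parking acts locally: a new gap ending at \<open>s\<close> must have its other end at an
  end of \<open>g\<close>, and any gap not ending at \<open>s\<close> was there before. This is what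
  makes sums over gaps easy to update.\<close>

lemma gaps_insert:
  assumes g: "g \<in> gaps L S" and s: "s \<in> g"
  shows "gaps L (insert s S) = insert (g \<inter> {..<s}) (insert (g \<inter> {s<..}) (gaps L S - {g}))"
    (is "_ = ?R")
proof -
  let ?T = "S \<union> {0, L + 1}"
  obtain x y where xy: "g = {x<..<y}" "x \<in> ?T" "y \<in> ?T" "?T \<inter> {x<..<y} = {}"
    using g by (rule gap_cases)
  have sxy: "x < s" "s < y"
    using s xy(1) by auto
  have left: "g \<inter> {..<s} = {x<..<s}" and right: "g \<inter> {s<..} = {s<..<y}"
    using xy(1) sxy by auto
  have "h \<in> ?R" if h: "h \<in> gaps L (insert s S)" for h
  proof -
    obtain u v where uv: "h = {u<..<v}" "u \<in> insert s S \<union> {0, L + 1}"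
        "v \<in> insert s S \<union> {0, L + 1}"
        "u < v" "(insert s S \<union> {0, L + 1}) \<inter> {u<..<v} = {}"
      using h by (rule gap_cases)
    have out: "t \<notin> {u<..<v}" if "t \<in> insert s S \<union> {0, L + 1}" for t
      using that uv(5) by (metis IntI empty_iff)
    have nx: "x \<notin> {u<..<v}" and ny: "y \<notin> {u<..<v}" and ns: "s \<notin> {u<..<v}"
      using xy(2,3) by (auto intro!: out simp del: greaterThanLessThan_iff)
    consider "u = s" | "v = s" | "u \<noteq> s" "v \<noteq> s"
      by blast
    then show ?thesis
    proof cases
      case 1
      then have "v \<in> ?T"
        using uv by auto
      then have "v \<notin> {x<..<y}"
        using xy(4) by blast
      then have "v = y"
        using 1 uv(4) ny sxy by auto
      then show ?thesis
        using 1 uv(1) right by simp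
    next
      case 2
      then have "u \<in> ?T"
        using uv by auto
      then have "u \<notin> {x<..<y}"
        using xy(4) by blast
      then have "u = x"
        using 2 uv(4) nx sxy by auto
      then show ?thesis
        using 2 uv(1) left by simp
    next
      case 3
      then have "h \<in> gaps L S"
        unfolding uv(1) using uv by (intro gapI) auto
      moreover have "h \<noteq> g"
        using s ns uv(1) by auto
      ultimately show ?thesis
        by blast
    qed
  qed
  moreover have "h \<in> gaps L (insert s S)" if h: "h \<in> ?R" for h
  proof -
    consider "h = {x<..<s}" | "h = {s<..<y}" | "h \<in> gaps L S" "h \<noteq> g"
      using h left right by blast
    then show ?thesis
    proof cases
      case 1
      have "insert s ?T \<inter> {x<..<s} = {}"
        using xy(4) sxy by fastforce
      then show ?thesis
        unfolding 1 using xy(2) sxy(1) by (intro gapI) auto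
    next
      case 2
      have "insert s ?T \<inter> {s<..<y} = {}"
        using xy(4) sxy by fastforce
      then show ?thesis
        unfolding 2 using xy(3) sxy(2) by (intro gapI) auto
    next
      case 3
      then have "s \<notin> h"
        using gaps_unique g s by blast
      moreover obtain u v where uv: "h = {u<..<v}" "u \<in> ?T" "v \<in> ?T" "u < v"
          "?T \<inter> {u<..<v} = {}"
        using 3(1) by (rule gap_cases)
      ultimately show ?thesis
        unfolding uv(1) by (intro gapI) auto
    qed
  qed
  ultimately show ?thesis
    by blast
qed

section \<open>Available slots, gap by gap\<close>

definition split_points :: "nat \<Rightarrow> nat set \<Rightarrow> nat set" where
  "split_points k g = {s \<in> g. k \<le> card (g \<inter> {..<s}) \<and> k \<le> card (g \<inter> {s<..})}"

lemma interval_Int_lessThan: "s \<in> {x<..<y} \<Longrightarrow> {x<..<y} \<inter> {..<s} = {x<..<s}" for s :: nat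
  by auto

lemma interval_Int_greaterThan: "s \<in> {x<..<y} \<Longrightarrow> {x<..<y} \<inter> {s<..} = {s<..<y}" for s :: nat
  by auto

lemma split_points_interval:
  "split_points k {x<..<y} = {s. x + k < s \<and> s + k < y}"
proof (rule set_eqI)
  fix s
  show "s \<in> split_points k {x<..<y} \<longleftrightarrow> s \<in> {s. x + k < s \<and> s + k < y}"
  proof (cases "s \<in> {x<..<y}")
    case True
    then have "x < s" "s < y" by auto
    then show ?thesis
      unfolding split_points_def
      by (auto simp: interval_Int_lessThan interval_Int_greaterThan)
  qed (auto simp: split_points_def)
qed

text \<open>The invariant of the process under which availability becomes a condition on one
  gap.\<close>

definition admissible :: "nat \<Rightarrow> nat \<Rightarrow> nat set \<Rightarrow> bool" where
  "admissible k L S \<longleftrightarrow> S \<subseteq> {1..L} \<and> (\<forall>g \<in> gaps L S. k \<le> card g)"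

text \<open>Availability tests every gap after insertion. By \<open>gaps_insert\<close> only the two
  halves of the split gap are new, and admissibility already vouches for the others.\<close>

lemma available_eq_split_points:
  assumes "admissible k L S"
  shows "available k L S = (\<Union>g \<in> gaps L S. split_points k g)"
proof -
  have S: "S \<subseteq> {1..L}" and ge: "\<And>g. g \<in> gaps L S \<Longrightarrow> k \<le> card g"
    using assms unfolding admissible_def by auto
  have iff: "s \<in> available k L S \<longleftrightarrow> s \<in> split_points k g" if "g \<in> gaps L S" "s \<in> g" for g s
  proof -
    have "s \<in> {1..L} - S"
      using gap_subset[OF S that(1)] gap_disjoint_config[OF that(1)] that(2) by blast
    then show ?thesis
      unfolding available_def split_points_def using that ge by (auto simp: gaps_insert)
  qed
  show ?thesis
  proof (intro set_eqI iffI)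
    fix s assume s: "s \<in> available k L S"
    then have "s \<in> {1..L} - S"
      by (auto simp: available_def)
    then obtain g where "g \<in> gaps L S" "s \<in> g"
      using ex_gap[OF S] by blast
    then show "s \<in> (\<Union>g \<in> gaps L S. split_points k g)"
      using iff s by blast
  next
    fix s assume "s \<in> (\<Union>g \<in> gaps L S. split_points k g)"
    then obtain g where g: "g \<in> gaps L S" "s \<in> split_points k g"
      by blast
    then have "s \<in> g"
      by (simp add: split_points_def)
    then show "s \<in> available k L S"
      using iff g by blast
  qed
qed

lemma admissible_insert:
  assumes "admissible k L S" "s \<in> available k L S"
  shows "admissible k L (insert s S)"
  using assms unfolding admissible_def available_def by auto

text \<open>The assumption \<open>k \<le> L\<close> starts the induction: the empty row is a single
  gap of size \<open>L\<close>.\<close>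

lemma admissible_config:
  assumes "k \<le> L" "S \<in> set_pmf (config k L t)"
  shows "admissible k L S"
  using assms(2)
proof (induction t arbitrary: S)
  case 0
  then show ?case
    using assms(1) by (simp add: admissible_def gaps_empty)
next
  case (Suc t)
  then obtain T where T: "T \<in> set_pmf (config k L t)" "S \<in> set_pmf (park_step k L T)"
    by auto
  then show ?case
    using Suc.IH[OF T(1)] admissible_insert
    by (auto simp: park_step_def finite_available split: if_splits)
qed

section \<open>Conservation of the potential\<close>

definition potential :: "nat \<Rightarrow> nat \<Rightarrow> nat \<Rightarrow> nat set \<Rightarrow> real" where
  "potential k r L S = (\<Sum>g \<in> gaps L S. gap_value k r (card g))"

definition split_increment :: "nat \<Rightarrow> nat \<Rightarrow> nat set \<Rightarrow> nat \<Rightarrow> real" where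
  "split_increment k r g s =
     gap_value k r (card (g \<inter> {..<s})) + gap_value k r (card (g \<inter> {s<..})) - gap_value k r (card g)"

lemma sum_split_increment:
  "(\<Sum>s \<in> split_points k {x<..<y}. split_increment k r {x<..<y} s) = 0"
proof (cases "y - x - 1 \<le> 2 * k")
  case True
  then have "split_points k {x<..<y} = {}"
    unfolding split_points_interval by auto
  then show ?thesis by simp
next
  case False
  define m where "m = y - x - 1"
  let ?v = "gap_value k r"
  have m: "2 * k < m" and y: "y = x + m + 1"
    using False by (auto simp: m_def)
  have "(\<Sum>s \<in> split_points k {x<..<y}. split_increment k r {x<..<y} s) =
      (\<Sum>j = k..<m - k. ?v j + ?v (m - 1 - j) - ?v m)"
  \<comment> \<open>The new index \<open>j\<close> is the number of free slots of the gap to the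
    left of \<open>s\<close>.\<close>
  proof (rule sum.reindex_bij_witness[of _ "\<lambda>j. j + x + 1" "\<lambda>s. s - x - 1"])
    fix s assume "s \<in> split_points k {x<..<y}"
    then have s: "x + k < s" "s + k < y"
      by (auto simp: split_points_interval)
    then show "s - x - 1 \<in> {k..<m - k}" "s - x - 1 + x + 1 = s"
      using y by auto
    have "s \<in> {x<..<y}" using s by auto
    moreover have "y - Suc s = m - 1 - (s - x - 1)"
      using s y by auto
    ultimately show "?v (s - x - 1) + ?v (m - 1 - (s - x - 1)) - ?v m =
        split_increment k r {x<..<y} s"
      unfolding split_increment_def interval_Int_lessThan[OF \<open>s \<in> {x<..<y}\<close>]
        interval_Int_greaterThan[OF \<open>s \<in> {x<..<y}\<close>]
      by (simp add: m_def)
  qed (use y m in \<open>auto simp: split_points_interval\<close>)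
  also have "\<dots> = (\<Sum>j = k..<m - k. ?v j) + (\<Sum>j = k..<m - k. ?v (m - 1 - j)) -
      (real m - 2 * real k) * ?v m"
    using m by (simp add: sum.distrib sum_subtractf of_nat_diff)
  \<comment> \<open>Reflecting the gap exchanges its two halves, so both sums agree and the
    recurrence cancels them against the \<open>m - 2 * k\<close> copies of
    \<open>?v m\<close>.\<close>
  also have "(\<Sum>j = k..<m - k. ?v (m - 1 - j)) = (\<Sum>j = k..<m - k. ?v j)"
    using m by (intro sum.reindex_bij_witness[of _ "\<lambda>j. m - 1 - j" "\<lambda>j. m - 1 - j"]) auto
  also have "(real m - 2 * real k) * ?v m = 2 * (\<Sum>j = k..<m - k. ?v j)"
    using m by (simp add: gap_value_large)
  finally show ?thesis by simp
qed

text \<open>Since \<open>gaps\<close> is a set, coinciding halves would be counted only once. As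
  \<open>1 \<le> k\<close>, both halves are nonempty, hence distinct from each other and from all
  remaining gaps.\<close>

lemma potential_insert:
  assumes k: "1 \<le> k" and S: "S \<subseteq> {1..L}" and g: "g \<in> gaps L S" and s: "s \<in> split_points k g"
  shows "potential k r L (insert s S) = potential k r L S + split_increment k r g s"
proof -
  let ?l = "g \<inter> {..<s}" and ?u = "g \<inter> {s<..}" and ?G = "gaps L S - {g}"
  let ?f = "\<lambda>h. gap_value k r (card h)"
  have sg: "s \<in> g" and "k \<le> card ?l" "k \<le> card ?u"
    using s by (auto simp: split_points_def)
  then obtain a b where a: "a \<in> ?l" and b: "b \<in> ?u"
    using k by (metis card.empty ex_in_conv not_one_le_zero order_trans)
  have "?l \<noteq> ?u"
    using a by fastforce
  moreover have "h \<notin> ?G" if "t \<in> h" "t \<in> g" for h t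
    using gaps_unique[OF g _ that(2,1)] by auto
  then have "?l \<notin> ?G" "?u \<notin> ?G"
    using a b by auto
  ultimately have "potential k r L (insert s S) = ?f ?l + (?f ?u + sum ?f ?G)"
    unfolding potential_def gaps_insert[OF g sg] using finite_gaps[OF S] by simp
  also have "sum ?f ?G = potential k r L S - ?f g"
    unfolding potential_def using finite_gaps[OF S] g by (simp add: sum_diff1)
  finally show ?thesis
    by (simp add: split_increment_def)
qed

text \<open>Distinct gaps have disjoint split points, so the total increment is a sum over gaps in
  which every term vanishes by \<open>sum_split_increment\<close>.\<close>

lemma sum_potential_available:
  assumes k: "1 \<le> k" and adm: "admissible k L S"
  shows "(\<Sum>s \<in> available k L S. potential k r L (insert s S)) =
    real (card (available k L S)) * potential k r L S"
proof -
  have S: "S \<subseteq> {1..L}"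
    using adm by (simp add: admissible_def)
  have fin: "finite (split_points k g)" if "g \<in> gaps L S" for g
    using gap_subset[OF S that] finite_subset[of "split_points k g" "{1..L}"]
    by (auto simp: split_points_def)
  have "(\<Sum>s \<in> available k L S. potential k r L (insert s S) - potential k r L S) =
      (\<Sum>g \<in> gaps L S. \<Sum>s \<in> split_points k g. potential k r L (insert s S) - potential k r L S)"
    unfolding available_eq_split_points[OF adm]
  proof (rule sum.UNION_disjoint)
    show "\<forall>g \<in> gaps L S. \<forall>h \<in> gaps L S. g \<noteq> h \<longrightarrow> split_points k g \<inter> split_points k h = {}"
      unfolding split_points_def by (metis (lifting) disjoint_iff gaps_unique mem_Collect_eq)
  qed (use finite_gaps[OF S] fin in auto)
  also have "\<dots> = (\<Sum>g \<in> gaps L S. \<Sum>s \<in> split_points k g. split_increment k r g s)"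
    by (intro sum.cong refl) (simp add: potential_insert[OF k S])
  also have "\<dots> = 0"
  proof (rule sum.neutral, rule ballI)
    fix g assume "g \<in> gaps L S"
    then obtain x y where "g = {x<..<y}"
      by (rule gap_cases) (rule that)
    then show "(\<Sum>s \<in> split_points k g. split_increment k r g s) = 0"
      by (simp only: sum_split_increment)
  qed
  finally show ?thesis
    by (simp add: sum_subtractf)
qed

text \<open>The martingale property of the potential; a stopped configuration satisfies it
  trivially.\<close>

lemma expectation_potential_park_step:
  assumes "1 \<le> k" "admissible k L S"
  shows "measure_pmf.expectation (park_step k L S) (potential k r L) = potential k r L S"
proof (cases "available k L S = {}")
  case True
  then show ?thesis by (simp add: park_step_def)
next
  case False
  then show ?thesis
    using sum_potential_available[OF assms]
    by (simp add: park_step_def integral_pmf_of_set finite_available)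
qed

section \<open>Expectation of the potential along the process\<close>

lemma finite_set_pmf_config: "finite (set_pmf (config k L t))"
proof (rule finite_subset)
  show "set_pmf (config k L t) \<subseteq> Pow {1..L}"
    using config_invariant by blast
qed simp

lemma finite_set_pmf_park_step: "finite (set_pmf (park_step k L S))"
  by (simp add: park_step_def finite_available)

lemma expectation_potential_config:
  assumes "1 \<le> k" "k \<le> L"
  shows "measure_pmf.expectation (config k L t) (potential k r L) = gap_value k r L"
proof (induction t)
  case 0
  then show ?case by (simp add: potential_def gaps_empty)
next
  case (Suc t)
  let ?A = "set_pmf (config k L t)"
  have "measure_pmf.expectation (config k L (Suc t)) (potential k r L) =
      (\<Sum>S \<in> ?A. pmf (config k L t) S *\<^sub>R
         measure_pmf.expectation (park_step k L S) (potential k r L))"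
    \<comment> \<open>Finite supports turn the bind into a finite sum over reachable configurations,
      all of them admissible.\<close>
    unfolding config.simps
    by (rule pmf_expectation_bind) (auto simp: finite_set_pmf_config finite_set_pmf_park_step)
  also have "\<dots> = (\<Sum>S \<in> ?A. pmf (config k L t) S *\<^sub>R potential k r L S)"
    using expectation_potential_park_step[OF assms(1)] admissible_config[OF assms(2)]
    by (intro sum.cong refl) simp
  also have "\<dots> = measure_pmf.expectation (config k L t) (potential k r L)"
    by (rule integral_measure_pmf[symmetric]) (auto simp: finite_set_pmf_config)
  finally show ?case
    using Suc.IH by simp
qed

section \<open>Stopped configurations and the expected number of gaps\<close>

lemma potential_stopped:
  assumes adm: "admissible k L S" and stop: "available k L S = {}"
  shows "potential k r L S = real (num_gaps r L S)"
proof -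
  have "gap_value k r (card g) = of_bool (card g = r)" if g: "g \<in> gaps L S" for g
  proof -
    obtain x y where xy: "g = {x<..<y}"
      using g by (rule gap_cases) (rule that)
    have "split_points k g = {}"
      using stop g available_eq_split_points[OF adm] by auto
    \<comment> \<open>This is the leftmost slot with \<open>k\<close> free slots before it in the
      gap; if even it fails, the gap has at most \<open>2 * k\<close> slots.\<close>
    then have "x + k + 1 \<notin> split_points k g"
      by simp
    then have "card g \<le> 2 * k"
      unfolding xy split_points_interval by auto
    then show ?thesis
      by (rule gap_value_small)
  qed
  moreover have "finite (gaps L S)"
    using adm finite_gaps by (auto simp: admissible_def)
  ultimately show ?thesis
    unfolding potential_def num_gaps_def by (simp add: of_bool_def sum.If_cases Int_def)
qed

lemma expected_gaps_eq_gap_value: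
  assumes "1 \<le> k" "1 \<le> n"
  shows "expected_gaps k r n = gap_value k r (n + k - 1)"
proof -
  let ?L = "n + k - 1"
  have L: "k \<le> ?L"
    using assms(2) by simp
  have "expected_gaps k r n = measure_pmf.expectation (final_config k ?L) (potential k r ?L)"
    unfolding expected_gaps_def
  proof (rule integral_cong_AE)
    show "AE S in measure_pmf (final_config k ?L). real (num_gaps r ?L S) = potential k r ?L S"
      using potential_stopped admissible_config[OF L] final_config_stopped
      by (auto simp: AE_measure_pmf_iff final_config_def)
  qed auto
  also have "\<dots> = gap_value k r ?L"
    unfolding final_config_def using expectation_potential_config[OF assms(1) L] .
  finally show ?thesis .
qed

theorem mainTheorem1:
  fixes k r :: nat
  assumes "1 \<le> k" and "k \<le> r" and "r \<le> 2 * k"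
  shows "(\<forall>n::nat. k + 2 \<le> n \<longrightarrow>
            expected_gaps k r n =
              2 / (real n - real k - 1) * (\<Sum>i = 1..n - k - 1. expected_gaps k r i)) \<and>
         expected_gaps k r (r - k + 1) = 1 \<and>
         (\<forall>n::nat. 1 \<le> n \<and> n \<le> k + 1 \<and> n \<noteq> r - k + 1 \<longrightarrow> expected_gaps k r n = 0)"
proof (intro conjI allI impI)
  note expected = expected_gaps_eq_gap_value[OF assms(1)]
  fix n :: nat
  assume n: "k + 2 \<le> n"
  \<comment> \<open>The shift \<open>j = i + k - 1\<close> passes from the index of a row to its
    number of slots.\<close>
  have "(\<Sum>i = 1..n - k - 1. expected_gaps k r i) =
      (\<Sum>j = k..<n + k - 1 - k. gap_value k r j)"
    using n assms(1)
    by (intro sum.reindex_bij_witness[of _ "\<lambda>j. j + 1 - k" "\<lambda>i. i + k - 1"])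
      (auto simp: expected)
  moreover have "real (n + k - 1) - 2 * real k = real n - real k - 1"
    using n by (simp add: of_nat_diff)
  ultimately show "expected_gaps k r n =
      2 / (real n - real k - 1) * (\<Sum>i = 1..n - k - 1. expected_gaps k r i)"
    using n by (simp add: expected gap_value_large)
next
  \<comment> \<open>This row has exactly \<open>r\<close> slots, too few for a car.\<close>
  show "expected_gaps k r (r - k + 1) = 1"
    using assms by (auto simp: expected_gaps_eq_gap_value gap_value_small)
next
  fix n :: nat
  \<comment> \<open>The bound \<open>n \<le> k + 1\<close> says that the row has at most
    \<open>2 * k\<close> slots, so the base case of \<open>gap_value\<close> applies.\<close>
  assume "1 \<le> n \<and> n \<le> k + 1 \<and> n \<noteq> r - k + 1"
  then show "expected_gaps k r n = 0"
    using assms by (auto simp: expected_gaps_eq_gap_value gap_value_small)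
qed

end
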